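(* Let $p=p(n)\in[0,1]$ satisfy $p=o(n^{-2/3})$, i.e. $p(n)\,n^{2/3}\to 0$ as $n\to\infty$, and let $A=A_n$ be the set of all integers $m$ with $n/2+1\le m\le n$. Then, asymptotically almost surely (i.e. with probability tending to $1$ as $n\to\infty$), the set $A\cup[n]_p$ admits a $2$-colouring of its elements with no monochromatic Schur triple.
   Context: $[n]:=\{1,2,\ldots,n\}$. $[n]_p$ denotes the random subset of $[n]$ in which each element of $[n]$ is included independently with probability $p$. A Schur triple is a triple of integers $(x,y,z)$ with $x+y=z$ (the integers $x$ and $y$ are not required to be distinct). A monochromatic Schur triple in a coloured set of integers is a Schur triple all of whose entries lie in the set and have the same colour. *)

theory Defs
  imports "HOL-Probability.Probability" "HOL-Library.Landau_Symbols"
begin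

definition random_subset :: "nat \<Rightarrow> real \<Rightarrow> nat set pmf" where
  "random_subset n p =
     map_pmf (\<lambda>f. {k \<in> {1..n}. f k}) (Pi_pmf {1..n} False (\<lambda>_. bernoulli_pmf p))"

definition schur_triple :: "nat \<Rightarrow> nat \<Rightarrow> nat \<Rightarrow> bool" where
  "schur_triple x y z \<longleftrightarrow> x + y = z"

(* Colourings are total functions; only their values on S matter. *)
definition mono_schur_triple ::
    "nat set \<Rightarrow> (nat \<Rightarrow> 'c) \<Rightarrow> nat \<Rightarrow> nat \<Rightarrow> nat \<Rightarrow> bool" where
  "mono_schur_triple S c x y z \<longleftrightarrow>
     schur_triple x y z \<and> x \<in> S \<and> y \<in> S \<and> z \<in> S \<and> c x = c y \<and> c y = c z"

definition schur_2_colourable :: "nat set \<Rightarrow> bool" where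
  "schur_2_colourable S \<longleftrightarrow>
     (\<exists>c :: nat \<Rightarrow> bool. \<not> (\<exists>x y z. mono_schur_triple S c x y z))"

definition upper_half :: "nat \<Rightarrow> nat set" where
  "upper_half n = {m. real n / 2 + 1 \<le> real m \<and> m \<le> n}"

end

theory Submission
  imports Defs
begin

text \<open>
  Colour every integer of the upper half with one colour and every other integer with the other
  one. A sum of two elements of the upper half is at least \<open>n + 2\<close>, so the first colour class is
  sum-free. The second colour class is contained in the random set, and for \<open>p = o(n powr (-2/3))\<close>
  the random set is itself sum-free asymptotically almost surely, by a first moment argument:
  a triple \<open>(x, y, x + y)\<close> with \<open>x \<noteq> y\<close> has three distinct entries and survives with probability
  \<open>p ^ 3\<close>, a triple \<open>(x, x, 2 * x)\<close> has two and survives with probability \<open>p ^ 2\<close>. There are at most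
  \<open>n ^ 2\<close> triples of the first kind and \<open>n\<close> of the second, hence some triple survives
  with probability at most \<open>n ^ 2 * p ^ 3 + n * p ^ 2\<close>. With \<open>q = p / n powr (-2/3)\<close>, which tends to \<open>0\<close>,
  the two summands are \<open>q ^ 3\<close> and \<open>q ^ 2 * n powr (-1/3)\<close>. So the exponent \<open>2/3\<close> is dictated by
  the nondegenerate triples.
\<close>

lemma upper_half_add_notin:
  assumes "x \<in> upper_half n" "y \<in> upper_half n"
  shows "x + y \<notin> upper_half n"
  using assms by (auto simp: upper_half_def)

text \<open>
  Membership in the upper half serves as the colouring, so elements of \<open>R\<close> inside the upper half
  take the colour of the upper half and do not have to be treated separately.
\<close>

lemma schur_2_colourable_upper_half_Un:
  assumes "\<And>x y. x \<in> R \<Longrightarrow> y \<in> R \<Longrightarrow> x + y \<notin> R"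
  shows "schur_2_colourable (upper_half n \<union> R)"
  unfolding schur_2_colourable_def
  using assms upper_half_add_notin
  by (intro exI[of _ "\<lambda>k. k \<in> upper_half n"])
     (auto simp: mono_schur_triple_def schur_triple_def)

lemma prob_Pi_pmf_bernoulli_all_True:
  assumes "finite A" "B \<subseteq> A" "0 \<le> p" "p \<le> 1"
  shows "measure_pmf.prob (Pi_pmf A False (\<lambda>_. bernoulli_pmf p)) {f. \<forall>k\<in>B. f k} = p ^ card B"
proof -
  have "{f. \<forall>k\<in>B. f k} = Pi A (\<lambda>k. if k \<in> B then {True} else UNIV)"
    using assms(2) by (auto simp: Pi_def split: if_splits)
  then have "measure_pmf.prob (Pi_pmf A False (\<lambda>_. bernoulli_pmf p)) {f. \<forall>k\<in>B. f k} =
      (\<Prod>k\<in>A. if k \<in> B then p else 1)"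
    using assms by (simp add: measure_Pi_pmf_Pi measure_pmf_single if_distrib cong: if_cong)
  also have "\<dots> = p ^ card B"
    using assms by (simp add: prod.If_cases Int_absorb1)
  finally show ?thesis .
qed

text \<open>
  The union bound over pairs of summands. Pairs on the diagonal are summed separately because
  their triple has only two distinct entries.
\<close>

lemma prob_exists_schur_triple_le:
  assumes "0 \<le> p" "p \<le> 1"
  shows "measure_pmf.prob (Pi_pmf {1..n} False (\<lambda>_. bernoulli_pmf p))
           {f. \<exists>x\<in>{1..n}. \<exists>y\<in>{1..n}. x + y \<le> n \<and> f x \<and> f y \<and> f (x + y)}
         \<le> real n ^ 2 * p ^ 3 + real n * p ^ 2" (is "measure ?M ?E \<le> _")
proof -
  let ?I = "{(x, y). x \<in> {1..n} \<and> y \<in> {1..n} \<and> x + y \<le> n}"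
  let ?D = "(\<lambda>x. (x, x)) ` {1..n}"
  let ?F = "\<lambda>(x, y). {f. \<forall>k\<in>{x, y, x + y}. f k} :: (nat \<Rightarrow> bool) set"
  (* Keeping p ^ 3 on the diagonal as well loses nothing asymptotically and makes this part of
     the weight constant on the whole square. *)
  let ?w = "\<lambda>i. (if i \<in> ?D then p ^ 2 else 0) + p ^ 3"
  have sub: "?I \<subseteq> {1..n} \<times> {1..n}" by auto
  then have fin: "finite ?I" by (rule finite_subset) auto
  have pair: "measure ?M (?F i) \<le> ?w i" if "i \<in> ?I" for i
  proof -
    obtain x y where i: "i = (x, y)" by (cases i)
    have xy: "x \<in> {1..n}" "y \<in> {1..n}" "x + y \<le> n" using that i by auto
    have "measure ?M (?F i) = p ^ card {x, y, x + y}"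
      unfolding i prod.case by (rule prob_Pi_pmf_bernoulli_all_True) (use xy assms in auto)
    moreover have "card {x, y, x + y} = (if x = y then 2 else 3)"
      using xy by auto
    moreover have "i \<in> ?D \<longleftrightarrow> x = y" using xy i by auto
    ultimately show ?thesis using assms by auto
  qed
  have "?E = (\<Union>i\<in>?I. ?F i)" by fastforce
  then have "measure ?M ?E \<le> (\<Sum>i\<in>?I. measure ?M (?F i))"
    using measure_pmf.finite_measure_subadditive_finite[OF fin, of ?F] by simp
  also have "\<dots> \<le> (\<Sum>i\<in>?I. ?w i)"
    by (rule sum_mono) (rule pair)
  also have "\<dots> \<le> (\<Sum>i\<in>{1..n} \<times> {1..n}. ?w i)"
    by (rule sum_mono2) (use sub assms in auto)
  also have "\<dots> = (\<Sum>i\<in>({1..n} \<times> {1..n}) \<inter> ?D. p ^ 2) + real n ^ 2 * p ^ 3"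
    unfolding sum.distrib by (subst sum.inter_restrict) (auto simp: power2_eq_square)
  also have "({1..n} \<times> {1..n}) \<inter> ?D = ?D" by auto
  also have "card ?D = n" by (simp add: card_image inj_on_def)
  then have "(\<Sum>i\<in>?D. p ^ 2) = real n * p ^ 2" by simp
  finally show ?thesis by simp
qed

lemma schur_triple_bound_tendsto_0:
  fixes p :: "nat \<Rightarrow> real"
  assumes "p \<in> o(\<lambda>n. real n powr (- 2 / 3))"
  shows "(\<lambda>n. real n ^ 2 * p n ^ 3 + real n * p n ^ 2) \<longlonglongrightarrow> 0"
proof -
  define q where "q = (\<lambda>n. p n / real n powr (- 2 / 3))"
  have q: "q \<longlonglongrightarrow> 0"
    unfolding q_def by (rule smalloD_tendsto[OF assms])
  have "(\<lambda>n. real n powr (- 1 / 3)) \<longlonglongrightarrow> 0"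
    by (rule tendsto_neg_powr) (auto simp: filterlim_real_sequentially)
  then have "(\<lambda>n. q n ^ 3 + q n ^ 2 * real n powr (- 1 / 3)) \<longlonglongrightarrow> 0 ^ 3 + 0 ^ 2 * 0"
    by (intro tendsto_intros q)
  moreover have "\<forall>\<^sub>F n in sequentially.
      q n ^ 3 + q n ^ 2 * real n powr (- 1 / 3) = real n ^ 2 * p n ^ 3 + real n * p n ^ 2"
    using eventually_gt_at_top[of 0]
  proof eventually_elim
    case (elim n)
    have p: "p n = q n * real n powr (- 2 / 3)" using elim by (simp add: q_def)
    have "(real n powr (- 2 / 3)) ^ 3 = real n powr (- 2)"
      using elim by (simp add: powr_powr flip: powr_numeral)
    then have "real n ^ 2 * (real n powr (- 2 / 3)) ^ 3 = 1"
      using elim by (simp add: powr_minus)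
    moreover have "real n * (real n powr (- 2 / 3)) ^ 2 = real n powr (- 1 / 3)"
      using elim by (simp add: powr_powr powr_mult_base flip: powr_numeral)
    ultimately show ?case
      by (simp add: p power_mult_distrib mult.left_commute[of "real n"]
          mult.left_commute[of "real n ^ 2"])
  qed
  ultimately show ?thesis
    by (auto intro: Lim_transform_eventually)
qed

theorem mainTheorem2:
  fixes p :: "nat \<Rightarrow> real"
  assumes "\<And>n. 0 \<le> p n \<and> p n \<le> 1"
    and "p \<in> o(\<lambda>n. real n powr (- 2 / 3))"
  shows "(\<lambda>n. measure_pmf.prob (random_subset n (p n))
            {R. schur_2_colourable (upper_half n \<union> R)}) \<longlonglongrightarrow> 1"
proof (rule tendsto_sandwich)
  let ?M = "\<lambda>n. Pi_pmf {1..n} False (\<lambda>_. bernoulli_pmf (p n))"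
  let ?E = "\<lambda>n. {f. \<exists>x\<in>{1..n}. \<exists>y\<in>{1..n}. x + y \<le> n \<and> f x \<and> f y \<and> f (x + y)}"
  let ?b = "\<lambda>n. real n ^ 2 * p n ^ 3 + real n * p n ^ 2"
  have "1 - ?b n \<le> measure_pmf.prob (random_subset n (p n))
            {R. schur_2_colourable (upper_half n \<union> R)}" for n
  proof -
    have "1 - ?b n \<le> 1 - measure_pmf.prob (?M n) (?E n)"
      using prob_exists_schur_triple_le[of "p n" n] assms(1)[of n] by simp
    also have "\<dots> = measure_pmf.prob (?M n) (- ?E n)"
      using measure_pmf.prob_compl[of "?E n" "?M n"] by (simp add: Compl_eq_Diff_UNIV)
    also have "\<dots> \<le> measure_pmf.prob (?M n)
        {f. schur_2_colourable (upper_half n \<union> {k \<in> {1..n}. f k})}"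
      by (intro measure_pmf.finite_measure_mono subsetI)
         (auto intro!: schur_2_colourable_upper_half_Un)
    also have "\<dots> = measure_pmf.prob (random_subset n (p n))
            {R. schur_2_colourable (upper_half n \<union> R)}"
      by (simp add: random_subset_def vimage_def)
    finally show ?thesis .
  qed
  then show "\<forall>\<^sub>F n in sequentially. 1 - ?b n \<le> measure_pmf.prob (random_subset n (p n))
            {R. schur_2_colourable (upper_half n \<union> R)}"
    by simp
  show "(\<lambda>n. 1 - ?b n) \<longlonglongrightarrow> 1"
    using tendsto_diff[OF tendsto_const schur_triple_bound_tendsto_0[OF assms(2)], of 1] by simp
qed (auto simp: measure_pmf.prob_le_1)

end
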